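(* Let $G$ be an infinite abelian group and suppose there is a subgroup $H$ of $G$ with $G/H\cong\mathbb{Z}$. Then for every integer $h\geq 1$, $X_G(h)\geq\left[\frac{h(h+4)}{3}\right]$.
   Context: $[x]$ denotes the integer part. For $A\subset G$ and a positive integer $h$, $hA$ is the set of sums of $h$ not necessarily distinct elements of $A$; $A\sim B$ means finite symmetric difference. $\operatorname{ord}^*_G(A)$ is the least $k$ with $kA\sim G$ ($\infty$ if none). $A$ is a basis if $\operatorname{ord}^*_G(A)<\infty$. For a basis $A$, $a\in A$ is regular if $A\setminus\{a\}$ is still a basis; $A^*$ is the set of regular elements. $X_G(h)=\sup\{\operatorname{ord}^*_G(A\setminus\{a\}) : A\subset G,\ hA\sim G,\ a\in A^*\}$. *)

theory Defs
  imports "HOL-Algebra.Algebra" "HOL-Library.Extended_Nat"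
begin

text \<open>
  Groups are written multiplicatively, following \<open>HOL-Algebra\<close>, so the \<open>k\<close>-fold sumset \<open>kA\<close>
  of an abelian group appears as a set of \<open>k\<close>-fold products.
\<close>

definition sumset :: "('a, 'b) monoid_scheme \<Rightarrow> nat \<Rightarrow> 'a set \<Rightarrow> 'a set" where
  "sumset G k A = {finprod G f {1..k} | f. f \<in> {1..k} \<rightarrow> A}"

definition almost_eq :: "'a set \<Rightarrow> 'a set \<Rightarrow> bool" where
  "almost_eq A B \<longleftrightarrow> finite (sym_diff A B)"

definition ord_star :: "('a, 'b) monoid_scheme \<Rightarrow> 'a set \<Rightarrow> enat" where
  "ord_star G A =
     (if \<exists>k\<ge>1. almost_eq (sumset G k A) (carrier G)
      then enat (LEAST k. k \<ge> 1 \<and> almost_eq (sumset G k A) (carrier G))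
      else \<infinity>)"

definition is_basis :: "('a, 'b) monoid_scheme \<Rightarrow> 'a set \<Rightarrow> bool" where
  "is_basis G A \<longleftrightarrow> A \<subseteq> carrier G \<and> ord_star G A < \<infinity>"

definition regular_elements :: "('a, 'b) monoid_scheme \<Rightarrow> 'a set \<Rightarrow> 'a set" where
  "regular_elements G A = {a \<in> A. is_basis G (A - {a})}"

definition X_fun :: "('a, 'b) monoid_scheme \<Rightarrow> nat \<Rightarrow> enat" where
  "X_fun G h =
     Sup {ord_star G (A - {a}) | A a.
       A \<subseteq> carrier G \<and> almost_eq (sumset G h A) (carrier G) \<and> a \<in> regular_elements G A}"

end

theory Submission
  imports Defs "HOL-Number_Theory.Cong"
begin

text \<open>
  Write \<open>m = h(h+4) div 3 + 1\<close>. Through \<open>G \<rightarrow> \<int> \<rightarrow> \<int>/m\<close>, let \<open>B\<close> be the preimage of two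
  consecutive residues \<open>u, u + 1\<close>, and \<open>A = B \<union> {0}\<close>. The set \<open>kB\<close> is the preimage of the
  \<open>k + 1\<close> residues \<open>ku, \<dots>, ku + k\<close>, so \<open>B\<close> is a basis of order exactly \<open>m - 1\<close>. On the other hand
  \<open>hA\<close> is everything as soon as the intervals \<open>{ku, \<dots>, ku + k}\<close> with \<open>1 \<le> k \<le> h\<close> together cover
  \<open>\<int>/m\<close>. This holds for a suitable \<open>u\<close> close to \<open>h\<close>: since \<open>m\<close> is about \<open>h\<^sup>2 / 3\<close>, the
  intervals wrap around the cycle three times, and each turn fills gaps left by the others.
\<close>

section \<open>Covering a cycle by intervals\<close>

text \<open>Dividing the representative \<open>x mod m\<close> by \<open>u\<close> gives a row
  \<open>q\<close> and a position \<open>r\<close> in it. Covering then means finding an interval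
  \<open>i\<close> and a number of turns \<open>c\<close> subject to inequalities only;
  \<open>j\<close> is the distance from the start of interval \<open>i\<close>.\<close>

lemma interval_cover_from_rows:
  fixes u m :: int
  assumes "u > 0" "m > 0"
    and rows: "\<And>q r. \<lbrakk>0 \<le> q; 0 \<le> r; r < u; u * q + r < m\<rbrakk> \<Longrightarrow>
      \<exists>i c. 1 \<le> i \<and> i \<le> h \<and> i * u \<le> u * q + r + c * m \<and> u * q + r + c * m \<le> i * u + i"
  shows "\<exists>k\<in>{1..nat h}. \<exists>j\<le>k. [x = int k * u + int j] (mod m)"
proof -
  define y where "y = x mod m"
  have y: "0 \<le> y" "y < m" using \<open>m > 0\<close> by (auto simp: y_def)
  have "0 \<le> y div u" "0 \<le> y mod u" "y mod u < u"
    using y \<open>u > 0\<close> by (simp_all add: pos_imp_zdiv_nonneg_iff)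
  from rows[OF this, unfolded mult_div_mod_eq, OF y(2)]
  obtain i c where ic: "1 \<le> i" "i \<le> h" "i * u \<le> y + c * m" "y + c * m \<le> i * u + i"
    by blast
  have "[x = y] (mod m)" by (simp add: y_def cong_def)
  also have "[y = y + c * m] (mod m)" by (simp add: cong_def)
  also have "y + c * m = int (nat i) * u + int (nat (y + c * m - i * u))" using ic by simp
  finally have "[x = int (nat i) * u + int (nat (y + c * m - i * u))] (mod m)" .
  moreover have "nat i \<in> {1..nat h}" "nat (y + c * m - i * u) \<le> nat i" using ic by auto
  ultimately show ?thesis by blast
qed

text \<open>
  The values of \<open>u\<close> below, one per residue of \<open>h\<close> modulo 3, were found by computer search. The
  facts \<open>turn1, turn2, turn3\<close> locate the intervals that start in or near row \<open>q\<close>, i.e.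
  \<open>{uq, \<dots>, uq + u - 1}\<close>, after one or two turns around the cycle.
\<close>

lemma rows_mod_0:
  fixes t :: int
  assumes t: "t \<ge> 1" and u: "u = 3 * t + 2" and m: "m = 3 * t * t + 4 * t + 1"
    and q: "0 \<le> q" and r: "0 \<le> r" "r < u" and qr: "u * q + r < m"
  shows "\<exists>i c. 1 \<le> i \<and> i \<le> 3 * t \<and> i * u \<le> u * q + r + c * m \<and> u * q + r + c * m \<le> i * u + i"
proof -
  have coverI: ?thesis if "1 \<le> i" "i \<le> 3 * t" "i * u \<le> u * q + r + c * m"
    "u * q + r + c * m \<le> i * u + i" for i c
    using that by blast
  \<comment> \<open>Relative to the start of row \<open>q\<close>, these intervals begin at
    \<open>t + 1\<close>, \<open>- t\<close> and \<open>2 * t + 2\<close>. The third is the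
    successor of the second, since \<open>- t + u = 2 * t + 2\<close>.\<close>
  have turn1: "(q + t + 1) * u = u * q + m + t + 1" and turn2: "(q + 2 * t + 1) * u = u * q + 2 * m - t"
    and turn3: "(q + 2 * t + 2) * u = u * q + 2 * m + 2 * t + 2"
    by (simp_all add: u m algebra_simps)
  have "m = u * t + 2 * t + 1" by (simp add: u m algebra_simps)
  then have "u * q < u * (t + 1)" using qr r t u by (simp add: algebra_simps)
  then have "q \<le> t" using t u by (simp add: mult_less_cancel_left)
  \<comment> \<open>In rows \<open>q < t\<close>, \<open>turn2\<close> covers the beginning,
    \<open>turn1\<close> the middle and \<open>turn3\<close> the end. In the incomplete row
    \<open>q = t\<close> the index in \<open>turn2\<close> would exceed \<open>3 * t\<close>, so
    interval \<open>q\<close> itself covers the beginning.\<close>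
  then consider "q = t" "r \<le> t" | "q = t" "r > t" | "q < t" "r \<le> t + 1"
    | "q < t" "t + 1 \<le> r" "r \<le> 2 * t + 2 + q" | "q < t - 1" "2 * t + 2 < r" | "q = t - 1" "2 * t + 2 + q < r"
    using q by linarith
  then show ?thesis
  proof cases
    case 1
    then show ?thesis using t r by (intro coverI[of q 0]) (linarith | simp add: mult.commute)+
  next
    case 2
    have "r \<le> 2 * t" using qr 2 by (simp add: u m algebra_simps)
    then show ?thesis using turn1 2 t r
      by (intro coverI[of "q + t + 1" 1]) linarith+
  next
    case 3
    then show ?thesis using turn2 t q r
      by (intro coverI[of "q + 2 * t + 1" 2]) linarith+
  next
    case 4
    then show ?thesis using turn1 t q r
      by (intro coverI[of "q + t + 1" 1]) linarith+
  next
    case 5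
    then show ?thesis using turn3 t q r u
      by (intro coverI[of "q + 2 * t + 2" 2]) linarith+
  next
    case 6
    \<comment> \<open>This case is empty: \<open>turn1\<close> already reaches
      \<open>2 * t + 2 + q = u - 1\<close>, the end of the row, where \<open>turn3\<close> would
      need the index \<open>3 * t + 1\<close>.\<close>
    then show ?thesis using r u by auto
  qed
qed

text \<open>The last row \<open>q = t - 1\<close> stops before \<open>2 * t\<close>, and
  \<open>turn2\<close> alone reaches \<open>q + t = 2 * t - 1\<close>. In every earlier row
  \<open>turn2\<close>, \<open>turn1\<close> and \<open>turn3\<close> follow one another from left
  to right, and \<open>q \<le> t - 2\<close> keeps all indices within
  \<open>3 * t - 2\<close>.\<close>

lemma rows_mod_1:
  fixes t :: int
  assumes t: "t \<ge> 2" and u: "u = 3 * t + 1" and m: "m = 3 * t * t - 1"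
    and q: "0 \<le> q" and r: "0 \<le> r" "r < u" and qr: "u * q + r < m"
  shows "\<exists>i c. 1 \<le> i \<and> i \<le> 3 * t - 2 \<and> i * u \<le> u * q + r + c * m \<and> u * q + r + c * m \<le> i * u + i"
proof -
  have coverI: ?thesis if "1 \<le> i" "i \<le> 3 * t - 2" "i * u \<le> u * q + r + c * m"
    "u * q + r + c * m \<le> i * u + i" for i c
    using that by blast
  have turn1: "(q + t) * u = u * q + m + t + 1" and turn2: "(q + 2 * t - 1) * u = u * q + 2 * m - t + 1"
    and turn3: "(q + 2 * t) * u = u * q + 2 * m + 2 * t + 2"
    by (simp_all add: u m algebra_simps)
  have m': "m = u * (t - 1) + 2 * t" by (simp add: u m algebra_simps)
  then have "u * q < u * t" using qr r t u by (simp add: algebra_simps)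
  then have "q < t" using t u by (simp add: mult_less_cancel_left)
  moreover have "r < 2 * t" if "q = t - 1" using qr that m' by simp
  ultimately consider "r \<le> q + t" | "q \<le> t - 2" "t + 1 \<le> r" "r \<le> 2 * t + 1 + q"
    | "q \<le> t - 2" "2 * t + 2 \<le> r"
    using q by linarith
  then show ?thesis
  proof cases
    case 1
    then show ?thesis using turn2 t q r \<open>q < t\<close>
      by (intro coverI[of "q + 2 * t - 1" 2]) linarith+
  next
    case 2
    then show ?thesis using turn1 t q r
      by (intro coverI[of "q + t" 1]) linarith+
  next
    case 3
    then show ?thesis using turn3 t q r u
      by (intro coverI[of "q + 2 * t" 2]) linarith+
  qed
qed

lemma rows_mod_2:
  fixes t :: int
  assumes t: "t \<ge> 2" and u: "u = 3 * t" and m: "m = 3 * t * t + 2 * t"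
    and q: "0 \<le> q" and r: "0 \<le> r" "r < u" and qr: "u * q + r < m"
  shows "\<exists>i c. 1 \<le> i \<and> i \<le> 3 * t - 1 \<and> i * u \<le> u * q + r + c * m \<and> u * q + r + c * m \<le> i * u + i"
proof -
  have coverI: ?thesis if "1 \<le> i" "i \<le> 3 * t - 1" "i * u \<le> u * q + r + c * m"
    "u * q + r + c * m \<le> i * u + i" for i c
    using that by blast
  have turn1: "(q + t + 1) * u = u * q + m + t" and turn2: "(q + 2 * t + 1) * u = u * q + 2 * m - t"
    and turn3: "(q + 2 * t + 2) * u = u * q + 2 * m + 2 * t"
    by (simp_all add: u m algebra_simps)
  have m': "m = u * t + 2 * t" by (simp add: u m algebra_simps)
  then have "u * q < u * (t + 1)" using qr r t u by (simp add: algebra_simps)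
  then have "q \<le> t" using t u by (simp add: mult_less_cancel_left)
  moreover have "r < 2 * t" if "q = t" using qr that m' by simp
  \<comment> \<open>The index in \<open>turn2\<close> is admissible only for
    \<open>q \<le> t - 2\<close>; beyond that, interval \<open>q\<close> reaches at least
    \<open>t - 1\<close>, just before \<open>turn1\<close> begins. The index in \<open>turn3\<close>
    requires \<open>q \<le> t - 3\<close>, but from \<open>q = t - 2\<close> on \<open>turn1\<close>
    reaches the end of the row.\<close>
  ultimately consider "q \<ge> t - 1" "r \<le> q" | "q \<le> t - 2" "r \<le> t"
    | "t \<le> r" "r \<le> 2 * t + 1 + q" | "q \<le> t - 3" "2 * t \<le> r"
    using q r u by linarith
  then show ?thesis
  proof cases
    case 1
    then show ?thesis using t r \<open>q \<le> t\<close>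
      by (intro coverI[of q 0]) (linarith | simp add: mult.commute)+
  next
    case 2
    then show ?thesis using turn2 t q r
      by (intro coverI[of "q + 2 * t + 1" 2]) linarith+
  next
    case 3
    then show ?thesis using turn1 t q r \<open>q \<le> t\<close>
      by (intro coverI[of "q + t + 1" 1]) linarith+
  next
    case 4
    then show ?thesis using turn3 t q r u
      by (intro coverI[of "q + 2 * t + 2" 2]) linarith+
  qed
qed

text \<open>The bounds on \<open>u\<close> keep 0 out of the residues \<open>u\<close> and
  \<open>u + 1\<close>, so that the identity can later be adjoined as a new element.\<close>

lemma exists_interval_cover:
  fixes h :: nat
  assumes "h \<ge> 2"
  defines "m \<equiv> int (h * (h + 4) div 3 + 1)"
  shows "\<exists>u. 0 < u \<and> u + 1 < m \<and>
    (\<forall>x. \<exists>k\<in>{1..h}. \<exists>j\<le>k. [x = int k * u + int j] (mod m))"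
proof -
  define s where "s = h div 3"
  have "h = 3 * s \<or> h = 3 * s + 1 \<or> h = 3 * s + 2" unfolding s_def by presburger
  then consider "h = 2" | "h = 3 * s" "s \<ge> 1" | "h = 3 * s + 1" "s \<ge> 1"
    | "h = 3 * s + 2" "s \<ge> 1"
    using \<open>h \<ge> 2\<close> by linarith
  then show ?thesis
  proof cases
    case 1
    \<comment> \<open>The family of \<open>rows_mod_2\<close> would give \<open>u = 3\<close> here,
      and \<open>{3, 4}\<close>, \<open>{6, 7, 8}\<close> miss 0 modulo 5. With
      \<open>u = 2\<close>, \<open>{2, 3}\<close> and \<open>{4, 5, 6}\<close> meet every residue
      exactly once.\<close>
    have "\<exists>k\<in>{1..nat 2}. \<exists>j\<le>k. [x = int k * 2 + int j] (mod 5)" for x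
    proof (rule interval_cover_from_rows)
      fix q r :: int
      assume "0 \<le> q" "0 \<le> r" "2 * q + r < 5"
      then consider "2 * q + r < 2" "0 \<le> 2 * q + r" | "2 \<le> 2 * q + r" "2 * q + r < 4"
        | "2 * q + r = 4"
        by linarith
      then show "\<exists>i c. 1 \<le> i \<and> i \<le> 2 \<and> i * 2 \<le> 2 * q + r + c * 5 \<and> 2 * q + r + c * 5 \<le> i * 2 + i"
      proof cases
        case 1
        then show ?thesis by - (rule exI[of _ 2], rule exI[of _ 1], simp)
      next
        case 2
        then show ?thesis by - (rule exI[of _ 1], rule exI[of _ 0], simp)
      next
        case 3
        then show ?thesis by - (rule exI[of _ 2], rule exI[of _ 0], simp)
      qed
    qed auto
    then show ?thesis using 1 by (intro exI[of _ 2]) (simp add: m_def)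
  next
    case 2
    define t where "t = int s"
    have "h * (h + 4) div 3 = s * (3 * s + 4)" by (simp add: 2)
    then have m: "m = 3 * t * t + 4 * t + 1" by (simp add: m_def t_def algebra_simps)
    have t: "t \<ge> 1" using 2 by (simp add: t_def)
    have h: "h = nat (3 * t)" using 2 by (simp add: t_def)
    have "3 * t * t \<ge> 3 * t" using t by (intro mult_right_mono) auto
    then have "3 * t + 2 + 1 < m" unfolding m using t by linarith
    then show ?thesis unfolding h using t
      by (intro exI[of _ "3 * t + 2"] conjI allI interval_cover_from_rows[OF _ _ rows_mod_0[OF t refl m]])
        linarith+
  next
    case 3
    define t where "t = int s + 1"
    \<comment> \<open>Only in this residue class does the integer part discard something.\<close>
    have "h * (h + 4) = 3 * (3 * s * s + 6 * s + 1) + 2" by (simp add: 3 algebra_simps)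
    then have "h * (h + 4) div 3 = 3 * s * s + 6 * s + 1" by presburger
    then have m: "m = 3 * t * t - 1" by (simp add: m_def t_def algebra_simps)
    have t: "t \<ge> 2" using 3 by (simp add: t_def)
    have h: "h = nat (3 * t - 2)" using 3 by (simp add: t_def)
    have "3 * t * t \<ge> 6 * t" using t by (intro mult_right_mono) auto
    then have "3 * t + 1 + 1 < m" unfolding m using t by linarith
    then show ?thesis unfolding h using t
      by (intro exI[of _ "3 * t + 1"] conjI allI interval_cover_from_rows[OF _ _ rows_mod_1[OF t refl m]])
        linarith+
  next
    case 4
    define t where "t = int s + 1"
    have "h * (h + 4) = 3 * (3 * s * s + 8 * s + 4)" by (simp add: 4 algebra_simps)
    then have "h * (h + 4) div 3 = 3 * s * s + 8 * s + 4" by presburger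
    then have m: "m = 3 * t * t + 2 * t" by (simp add: m_def t_def algebra_simps)
    have t: "t \<ge> 2" using 4 by (simp add: t_def)
    have h: "h = nat (3 * t - 1)" using 4 by (simp add: t_def)
    have "3 * t * t \<ge> 3 * t" using t by (intro mult_right_mono) auto
    then have "3 * t + 1 < m" unfolding m using t by linarith
    then show ?thesis unfolding h using t
      by (intro exI[of _ "3 * t"] conjI allI interval_cover_from_rows[OF _ _ rows_mod_2[OF t refl m]])
        linarith+
  qed
qed

section \<open>Sumsets and orders\<close>

context comm_group
begin

lemma sumset_subset_carrier: "A \<subseteq> carrier G \<Longrightarrow> sumset G k A \<subseteq> carrier G"
  by (auto simp: sumset_def intro!: finprod_closed)

lemma sumset_one:
  assumes "A \<subseteq> carrier G"
  shows "sumset G 1 A = A"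
proof -
  have "finprod G f {1..1} = f 1" if "f \<in> {1..1::nat} \<rightarrow> A" for f
    using that assms by (auto simp: Pi_iff)
  then have "sumset G 1 A = {f (1::nat) | f. f \<in> {1..1} \<rightarrow> A}"
    unfolding sumset_def by (intro Collect_cong) (metis (no_types, lifting))
  also have "\<dots> = A" by (auto intro!: exI[of _ "\<lambda>_. x" for x])
  finally show ?thesis .
qed

lemma mult_mem_sumset_Suc:
  assumes "A \<subseteq> carrier G" "y \<in> sumset G k A" "a \<in> A"
  shows "a \<otimes> y \<in> sumset G (Suc k) A"
proof -
  obtain f where f: "y = finprod G f {1..k}" "f \<in> {1..k} \<rightarrow> A"
    using assms(2) by (auto simp: sumset_def)
  define g where "g = f(Suc k := a)"
  have g: "g \<in> {1..Suc k} \<rightarrow> A" using f(2) assms(3) by (auto simp: g_def)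
  have "{1..Suc k} = insert (Suc k) {1..k}" by auto
  moreover have "finprod G g (insert (Suc k) {1..k}) = g (Suc k) \<otimes> finprod G g {1..k}"
    using g assms(1) by (intro finprod_insert) auto
  ultimately have "finprod G g {1..Suc k} = g (Suc k) \<otimes> finprod G g {1..k}" by simp
  moreover have "finprod G g {1..k} = y"
    unfolding f(1) using f(2) assms(1) by (intro finprod_cong') (auto simp: g_def)
  moreover have "g (Suc k) = a" by (simp add: g_def)
  ultimately have "a \<otimes> y = finprod G g {1..Suc k}" by simp
  with g show ?thesis by (auto simp: sumset_def)
qed

text \<open>Products are padded with \<open>\<one>\<close>. This lets the \<open>h\<close>-fold
  sumset of \<open>A\<close> collect the \<open>k\<close>-fold sumsets of \<open>B\<close> for all
  \<open>k\<close> from 1 to \<open>h\<close>.\<close>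

lemma sumset_mono_index:
  assumes "A \<subseteq> carrier G" "\<one> \<in> A" "k \<le> l"
  shows "sumset G k A \<subseteq> sumset G l A"
  using assms(3)
proof (induction l rule: dec_induct)
  case (step n)
  have "x \<in> sumset G (Suc n) A" if "x \<in> sumset G n A" for x
    using mult_mem_sumset_Suc[OF assms(1) that assms(2)] subsetD[OF sumset_subset_carrier[OF assms(1)] that]
    by simp
  with step.IH show ?case by blast
qed simp

end

lemma sumset_mono_set: "A \<subseteq> B \<Longrightarrow> sumset G k A \<subseteq> sumset G k B"
  unfolding sumset_def by blast

lemma le_ord_starI:
  assumes "\<And>k. k \<ge> 1 \<Longrightarrow> almost_eq (sumset G k A) (carrier G) \<Longrightarrow> n \<le> k"
  shows "enat n \<le> ord_star G A"
proof (cases "\<exists>k\<ge>1. almost_eq (sumset G k A) (carrier G)")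
  case True
  define l where "l = (LEAST k. k \<ge> 1 \<and> almost_eq (sumset G k A) (carrier G))"
  have "l \<ge> 1 \<and> almost_eq (sumset G l A) (carrier G)"
    unfolding l_def using True by (rule LeastI_ex)
  then have "n \<le> l" using assms by blast
  then show ?thesis unfolding ord_star_def l_def[symmetric] using True by simp
qed (auto simp: ord_star_def)

lemma is_basisI:
  assumes "A \<subseteq> carrier G" "k \<ge> 1" "almost_eq (sumset G k A) (carrier G)"
  shows "is_basis G A"
  using assms by (auto simp: is_basis_def ord_star_def)

lemma ord_star_le_X_fun:
  assumes "A \<subseteq> carrier G" "almost_eq (sumset G h A) (carrier G)" "a \<in> A" "is_basis G (A - {a})"
  shows "ord_star G (A - {a}) \<le> X_fun G h"
  unfolding X_fun_def using assms by (intro Sup_upper) (auto simp: regular_elements_def)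

section \<open>Preimages of two consecutive residues\<close>

locale epi_to_integers = comm_group G for G (structure) +
  fixes \<phi> :: "'a \<Rightarrow> int"
  assumes hom_mult: "\<lbrakk>x \<in> carrier G; y \<in> carrier G\<rbrakk> \<Longrightarrow> \<phi> (x \<otimes> y) = \<phi> x + \<phi> y"
    and onto: "\<exists>x\<in>carrier G. \<phi> x = n"
begin

lemma hom_one: "\<phi> \<one> = 0"
  using hom_mult[of \<one> \<one>] by simp

lemma hom_inv: "x \<in> carrier G \<Longrightarrow> \<phi> (inv x) = - \<phi> x"
  using hom_mult[of x "inv x"] hom_one by simp

lemma hom_finprod:
  "f \<in> I \<rightarrow> carrier G \<Longrightarrow> \<phi> (finprod G f I) = (\<Sum>i\<in>I. \<phi> (f i))"
  by (induction I rule: infinite_finite_induct) (auto simp: hom_one hom_mult Pi_iff)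

text \<open>The image under \<open>\<phi>\<close> contains a whole arithmetic progression. Hence a
  sumset that misses even one residue differs from \<open>G\<close> in infinitely many
  elements.\<close>

lemma infinite_residue_class:
  assumes "m \<noteq> 0"
  shows "infinite {x \<in> carrier G. [\<phi> x = c] (mod m)}"
proof
  assume "finite {x \<in> carrier G. [\<phi> x = c] (mod m)}" (is "finite ?C")
  moreover have "range (\<lambda>n. c + n * m) \<subseteq> \<phi> ` ?C"
  proof clarify
    fix n
    obtain x where "x \<in> carrier G" "\<phi> x = c + n * m" using onto by blast
    then show "c + n * m \<in> \<phi> ` ?C" by (auto simp: cong_def intro!: image_eqI[of _ _ x])
  qed
  ultimately have "finite (range (\<lambda>n. c + n * m))" by (meson finite_imageI finite_subset)
  moreover have "inj (\<lambda>n. c + n * m)" using assms by (auto simp: inj_def)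
  ultimately show False using finite_imageD infinite_UNIV_int by blast
qed

definition residue_pair :: "int \<Rightarrow> int \<Rightarrow> 'a set" where
  "residue_pair m u = {x \<in> carrier G. [\<phi> x = u] (mod m) \<or> [\<phi> x = u + 1] (mod m)}"

lemma residue_pair_subset_carrier: "residue_pair m u \<subseteq> carrier G"
  by (auto simp: residue_pair_def)

lemma mem_sumset_residue_pair:
  assumes "x \<in> carrier G" "j \<le> k" "k \<ge> 1" "[\<phi> x = int k * u + int j] (mod m)"
  shows "x \<in> sumset G k (residue_pair m u)"
  using assms(3,1,2,4)
proof (induction k arbitrary: x j rule: dec_induct)
  case base
  then consider "j = 0" | "j = 1" by linarith
  then have "x \<in> residue_pair m u" using base by cases (auto simp: residue_pair_def)
  then show ?case using sumset_one[OF residue_pair_subset_carrier] by simp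
next
  case (step k)
  \<comment> \<open>One factor of residue \<open>u + e\<close> is split off. Taking
    \<open>e = 1\<close> unless \<open>j = 0\<close> leaves \<open>j - e \<le> k\<close>, as the
    induction hypothesis demands; the cofactor is controlled by its \<open>\<phi>\<close>-value
    alone because the residue pair is a full preimage.\<close>
  obtain e :: nat where e: "e \<le> 1" "e \<le> j" "j - e \<le> k"
    using step.prems(2) by (cases j) (auto intro: that[of 0] that[of 1])
  obtain g where g: "g \<in> carrier G" "\<phi> g = u + int e" using onto by blast
  then have gB: "g \<in> residue_pair m u" using e(1) by (cases e) (auto simp: residue_pair_def)
  define y where "y = inv g \<otimes> x"
  have y: "y \<in> carrier G" "g \<otimes> y = x"
    using g step.prems(1) by (simp_all add: y_def m_assoc[symmetric])
  have "\<phi> y = \<phi> x - (u + int e)" using g step.prems(1) by (simp add: y_def hom_mult hom_inv)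
  moreover have "[\<phi> x - (u + int e) = int (Suc k) * u + int j - (u + int e)] (mod m)"
    using step.prems(3) by (intro cong_diff) auto
  moreover have "int (Suc k) * u + int j - (u + int e) = int k * u + int (j - e)"
    using e(2) by (simp add: algebra_simps)
  ultimately have "y \<in> sumset G k (residue_pair m u)"
    using step.IH[of y "j - e"] y e(3) by simp
  then show ?case
    using mult_mem_sumset_Suc[OF residue_pair_subset_carrier _ gB] y(2) by fastforce
qed

lemma sumset_residue_pairD:
  assumes "x \<in> sumset G k (residue_pair m u)"
  shows "\<exists>j\<le>k. [\<phi> x = int k * u + int j] (mod m)"
proof -
  obtain f where f: "x = finprod G f {1..k}" "f \<in> {1..k} \<rightarrow> residue_pair m u"
    using assms by (auto simp: sumset_def)
  \<comment> \<open>\<open>j\<close> will be the number of factors counted as having residue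
    \<open>u + 1\<close>.\<close>
  define e :: "nat \<Rightarrow> nat" where "e i = (if [\<phi> (f i) = u] (mod m) then 0 else 1)" for i
  have e: "[\<phi> (f i) = u + int (e i)] (mod m)" if "i \<in> {1..k}" for i
    using f(2) that by (auto simp: e_def residue_pair_def Pi_iff)
  have "\<phi> x = (\<Sum>i\<in>{1..k}. \<phi> (f i))"
    unfolding f(1) using f(2) residue_pair_subset_carrier by (intro hom_finprod) auto
  also have "[\<dots> = (\<Sum>i\<in>{1..k}. u + int (e i))] (mod m)" using e by (rule cong_sum)
  also have "(\<Sum>i\<in>{1..k}. u + int (e i)) = int k * u + int (sum e {1..k})"
    by (simp add: sum.distrib)
  finally have "[\<phi> x = int k * u + int (sum e {1..k})] (mod m)" .
  moreover have "sum e {1..k} \<le> k" using sum_bounded_above[of "{1..k}" e 1] by (simp add: e_def)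
  ultimately show ?thesis by blast
qed

text \<open>The residues reached are \<open>k + 1 < m\<close> consecutive ones, so the next one,
  \<open>k * u + k + 1\<close>, is missed together with its infinite class.\<close>

lemma sumset_residue_pair_not_almost_eq:
  assumes "int k + 1 < m"
  shows "\<not> almost_eq (sumset G k (residue_pair m u)) (carrier G)"
proof
  assume "almost_eq (sumset G k (residue_pair m u)) (carrier G)"
  then have fin: "finite (carrier G - sumset G k (residue_pair m u))" by (simp add: almost_eq_def)
  have "x \<notin> sumset G k (residue_pair m u)" if x: "[\<phi> x = int k * u + (int k + 1)] (mod m)" for x
  proof
    assume "x \<in> sumset G k (residue_pair m u)"
    then obtain j where j: "j \<le> k" "[\<phi> x = int k * u + int j] (mod m)"
      using sumset_residue_pairD by blast
    have "[int k + 1 = int j] (mod m)"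
      using cong_trans[OF cong_sym[OF x] j(2)] by (simp only: cong_add_lcancel)
    then show False using assms j(1) by (simp add: cong_def)
  qed
  then have "{x \<in> carrier G. [\<phi> x = int k * u + (int k + 1)] (mod m)}
      \<subseteq> carrier G - sumset G k (residue_pair m u)"
    by blast
  then have "finite {x \<in> carrier G. [\<phi> x = int k * u + (int k + 1)] (mod m)}"
    using fin by (rule finite_subset)
  then show False using infinite_residue_class[of m] assms by simp
qed

lemma sumset_residue_pair_eq_carrier:
  assumes "m \<ge> 2"
  shows "sumset G (nat (m - 1)) (residue_pair m u) = carrier G"
proof
  show "carrier G \<subseteq> sumset G (nat (m - 1)) (residue_pair m u)"
  proof
    fix x assume x: "x \<in> carrier G"
    define k where "k = nat (m - 1)"
    \<comment> \<open>For \<open>k = m - 1\<close> the \<open>k + 1\<close> consecutive residues are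
      a complete system, so reducing modulo \<open>m\<close> always gives an admissible
      \<open>j\<close>.\<close>
    define j where "j = nat ((\<phi> x - int k * u) mod m)"
    have "int j = (\<phi> x - int k * u) mod m" using assms by (simp add: j_def)
    then have "[\<phi> x = int k * u + int j] (mod m)" by (simp add: cong_def mod_simps)
    moreover have "(\<phi> x - int k * u) mod m \<le> m - 1" using assms by simp
    then have "j \<le> k" unfolding j_def k_def by (rule nat_mono)
    moreover have "k \<ge> 1" using assms by (simp add: k_def)
    ultimately show "x \<in> sumset G (nat (m - 1)) (residue_pair m u)"
      using x mem_sumset_residue_pair unfolding k_def by blast
  qed
qed (rule sumset_subset_carrier[OF residue_pair_subset_carrier])

lemma X_fun_ge_of_interval_cover:
  assumes u: "0 < u" "u + 1 < m"
    and cover: "\<And>x. \<exists>k\<in>{1..h}. \<exists>j\<le>k. [x = int k * u + int j] (mod m)"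
  shows "enat (nat (m - 1)) \<le> X_fun G h"
proof -
  let ?B = "residue_pair m u" and ?A = "insert \<one> (residue_pair m u)"
  note B = residue_pair_subset_carrier[of m u]
  have A: "?A \<subseteq> carrier G" using B by simp
  \<comment> \<open>This makes the deletion of \<open>\<one>\<close> from \<open>?A\<close> return
    exactly \<open>?B\<close>.\<close>
  have "\<one> \<notin> ?B" using u by (auto simp: residue_pair_def hom_one cong_def)
  then have diff: "?A - {\<one>} = ?B" by simp
  have "x \<in> sumset G h ?A" if x: "x \<in> carrier G" for x
  proof -
    obtain k j where "k \<in> {1..h}" "j \<le> k" "[\<phi> x = int k * u + int j] (mod m)"
      using cover by blast
    then have "x \<in> sumset G k ?B" "k \<le> h" using mem_sumset_residue_pair[OF x] by auto
    then show ?thesis using sumset_mono_set[of ?B ?A] sumset_mono_index[OF A] by blast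
  qed
  then have "sumset G h ?A = carrier G" using sumset_subset_carrier[OF A] by blast
  then have "almost_eq (sumset G h ?A) (carrier G)" by (simp add: almost_eq_def)
  moreover have "is_basis G ?B"
    using u sumset_residue_pair_eq_carrier[of m u]
    by (intro is_basisI[OF B, of "nat (m - 1)"]) (auto simp: almost_eq_def)
  ultimately have "ord_star G ?B \<le> X_fun G h"
    using ord_star_le_X_fun[OF A, of h \<one>] diff by simp
  moreover have "enat (nat (m - 1)) \<le> ord_star G ?B"
  proof (rule le_ord_starI)
    fix k assume "almost_eq (sumset G k ?B) (carrier G)"
    then show "nat (m - 1) \<le> k" using sumset_residue_pair_not_almost_eq[of k m u] by linarith
  qed
  ultimately show ?thesis by (rule order_trans[rotated])
qed

end

section \<open>The map onto the integers, the case \<open>h = 1\<close>, and the conclusion\<close>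

lemma (in comm_group) epi_to_integers_of_quotient_iso:
  assumes "subgroup H G" "G Mod H \<cong> integer_group"
  shows "\<exists>\<phi>. epi_to_integers G \<phi>"
proof -
  interpret normal H G using assms(1) by (rule subgroup_imp_normal)
  obtain \<psi> where \<psi>: "\<psi> \<in> iso (G Mod H) integer_group" using assms(2) by (auto simp: is_iso_def)
  have "epi_to_integers G (\<lambda>x. \<psi> (H #> x))"
  proof (unfold_locales)
    fix x y assume "x \<in> carrier G" "y \<in> carrier G"
    then show "\<psi> (H #> x \<otimes> y) = \<psi> (H #> x) + \<psi> (H #> y)"
      using r_coset_hom_Mod \<psi> by (auto simp: iso_def hom_def Pi_iff)
  next
    fix n
    have "n \<in> \<psi> ` carrier (G Mod H)" using \<psi> by (auto simp: iso_def bij_betw_def)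
    then show "\<exists>x\<in>carrier G. \<psi> (H #> x) = n" by (auto simp: FactGroup_def RCOSETS_def)
  qed
  then show ?thesis by blast
qed

text \<open>For \<open>h = 1\<close> the modulus would be 2, leaving no \<open>u\<close> with
  \<open>0 < u\<close> and \<open>u + 1 < m\<close>. Instead the identity is deleted from
  \<open>G\<close> itself, a finite change, and any order is at least 1 because
  \<open>ord_star\<close> only admits \<open>k \<ge> 1\<close>.\<close>

lemma (in comm_group) X_fun_1_ge_1: "1 \<le> X_fun G 1"
proof -
  have "almost_eq (sumset G 1 (carrier G)) (carrier G)"
    using sumset_one[of "carrier G"] by (simp add: almost_eq_def)
  moreover have "is_basis G (carrier G - {\<one>})"
  proof (rule is_basisI)
    have "sym_diff (carrier G - {\<one>}) (carrier G) \<subseteq> {\<one>}" by blast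
    then show "almost_eq (sumset G 1 (carrier G - {\<one>})) (carrier G)"
      using sumset_one[of "carrier G - {\<one>}"] by (auto simp: almost_eq_def intro: finite_subset)
  qed auto
  ultimately have "ord_star G (carrier G - {\<one>}) \<le> X_fun G 1"
    by (intro ord_star_le_X_fun) auto
  moreover have "enat 1 \<le> ord_star G (carrier G - {\<one>})" by (rule le_ord_starI)
  ultimately show ?thesis by (simp add: one_enat_def)
qed

theorem theorem1p4:
  fixes G :: "('a, 'b) monoid_scheme" and h :: nat
  assumes "comm_group G"
    and "infinite (carrier G)"
    and "\<exists>H. subgroup H G \<and> (G Mod H) \<cong> integer_group"
    and "h \<ge> 1"
  shows "X_fun G h \<ge> enat (h * (h + 4) div 3)"
proof (cases "h = 1")
  case True
  then show ?thesis using comm_group.X_fun_1_ge_1[OF assms(1)] by (simp add: one_enat_def)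
next
  case False
  obtain \<phi> where "epi_to_integers G \<phi>"
    using assms(3) comm_group.epi_to_integers_of_quotient_iso[OF assms(1)] by blast
  moreover obtain u where "0 < u" "u + 1 < int (h * (h + 4) div 3 + 1)"
    "\<And>x. \<exists>k\<in>{1..h}. \<exists>j\<le>k. [x = int k * u + int j] (mod int (h * (h + 4) div 3 + 1))"
    using exists_interval_cover[of h] False assms(4) by auto
  ultimately have "enat (nat (int (h * (h + 4) div 3 + 1) - 1)) \<le> X_fun G h"
    by (rule epi_to_integers.X_fun_ge_of_interval_cover)
  then show ?thesis by simp
qed

end
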